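(* Let $\alpha\in[0,\infty)^n$ be non-increasing and let $f\colon\mathcal{B}_n\to\mathcal{H}_d$ satisfy $\|f(x)-f(y)\|\le d_\alpha(x,y)$ for all $x,y$. Let $X$ be a $k$-homogeneous $\mathcal{B}_n$-valued random vector satisfying the stochastic covering property. Define random variables $Y_1,\dots,Y_k$ by: conditionally on $X$, $Y_1$ is uniform on $\mathrm{supp}\,X\setminus\{1,\dots,k\}$, and for $l=2,\dots,k$, conditionally on $X,Y_1,\dots,Y_{l-1}$, $Y_l$ is uniform on $\mathrm{supp}\,X\setminus(\{1,\dots,k\}\cup\{Y_1,\dots,Y_{l-1}\})$, where $\mathrm{supp}\,X=\{i:X_i=1\}$ and the uniform distribution on the empty set is the Dirac mass at $0$. Let $\mathcal{G}_0$ be trivial, $\mathcal{G}_l=\sigma(X_1,\dots,X_l)$ for $l\in[k]$ and $\mathcal{G}_{k+r}=\sigma(X_1,\dots,X_k,Y_1,\dots,Y_r)$ for $r\in[k]$, and $N_l=\mathbb{E}[f(X)\mid\mathcal{G}_l]-\mathbb{E}[f(X)\mid\mathcal{G}_{l-1}]$ for $l\in[2k]$. Then $N_l^2\preccurlyeq4\alpha_l^2I_d$ for $l\in[k]$, and $N_l^2\preccurlyeq4\alpha_k^2I_d$ for $l=k+1,\dots,2k$.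
   Context: $\mathcal{B}_n=\{0,1\}^n$, $\mathcal{H}_d$ the $d\times d$ Hermitian matrices, $\|\cdot\|$ operator norm, $\preccurlyeq$ positive semidefinite order, $I_d$ identity. $d_\alpha(x,y)=\sum_i\alpha_i\mathbf{1}\{x_i\ne y_i\}$. $X$ is $k$-homogeneous if a.s. exactly $k$ of its coordinates equal $1$. For $S\subset[n]$, $x_S=(x_i)_{i\in S}$; $x\triangleright y$ means $x=y$ or $x=y+e_i$. $X$ satisfies the stochastic covering property if for every $S\subset[n]$ and $x,y$ with $x_S\triangleright y_S$ there is a coupling $(U,V)$ of $\mathcal{L}(X_{S^c}\mid X_S=y_S)$ and $\mathcal{L}(X_{S^c}\mid X_S=x_S)$ with $U\triangleright V$ a.s. *)

theory Defs
  imports "HOL-Analysis.Analysis" "HOL-Probability.Probability"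
begin

text \<open>Points of B_n are encoded as subsets of {1..n}: x_i = 1 iff i is in the set.
  Restriction x_S is encoded as x \<inter> S (coordinates in S).\<close>

definition dist_alpha :: "nat \<Rightarrow> (nat \<Rightarrow> real) \<Rightarrow> nat set \<Rightarrow> nat set \<Rightarrow> real" where
  "dist_alpha n \<alpha> x y = (\<Sum>i\<in>{1..n}. \<alpha> i * (if (i \<in> x) \<noteq> (i \<in> y) then 1 else 0))"

definition hermitian_mat :: "complex^'d^'d \<Rightarrow> bool" where
  "hermitian_mat A \<longleftrightarrow> (\<forall>i j. A $ i $ j = cnj (A $ j $ i))"

text \<open>Positive semidefinite (complex quadratic form v^* M v real and nonnegative for all v).\<close>
definition psd_mat :: "complex^'d^'d \<Rightarrow> bool" where
  "psd_mat M \<longleftrightarrow> (\<forall>v::complex^'d. let q = (\<Sum>i\<in>UNIV. cnj (v $ i) * (M *v v) $ i)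
                      in Im q = 0 \<and> 0 \<le> Re q)"

definition psd_le :: "complex^'d^'d \<Rightarrow> complex^'d^'d \<Rightarrow> bool" where
  "psd_le A B \<longleftrightarrow> psd_mat (B - A)"

definition op_norm :: "complex^'d^'d \<Rightarrow> real" where
  "op_norm A = onorm (\<lambda>v::complex^'d. A *v v)"

text \<open>x \<triangleright> y for 0/1-vectors with coordinate set I: x = y or x = y + e_i, i in I.\<close>
definition covers :: "nat set \<Rightarrow> nat set \<Rightarrow> nat set \<Rightarrow> bool" where
  "covers I x y \<longleftrightarrow> x = y \<or> (\<exists>i\<in>I. i \<notin> y \<and> x = insert i y)"

text \<open>Law of X_{S^c} given X_S = z (z a subset of S).\<close>
definition cond_law_compl :: "nat set pmf \<Rightarrow> nat set \<Rightarrow> nat set \<Rightarrow> nat set pmf" where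
  "cond_law_compl X S z = map_pmf (\<lambda>A. A - S) (cond_pmf X {A. A \<inter> S = z})"

definition stoch_covering :: "nat \<Rightarrow> nat set pmf \<Rightarrow> bool" where
  "stoch_covering n X \<longleftrightarrow>
    (\<forall>S x y. S \<subseteq> {1..n} \<and> x \<subseteq> {1..n} \<and> y \<subseteq> {1..n} \<and> covers S (x \<inter> S) (y \<inter> S)
       \<and> set_pmf X \<inter> {A. A \<inter> S = x \<inter> S} \<noteq> {} \<and> set_pmf X \<inter> {A. A \<inter> S = y \<inter> S} \<noteq> {}
     \<longrightarrow> (\<exists>c :: (nat set \<times> nat set) pmf.
            map_pmf fst c = cond_law_compl X S (y \<inter> S) \<and>
            map_pmf snd c = cond_law_compl X S (x \<inter> S) \<and>
            (\<forall>(u, v)\<in>set_pmf c. covers ({1..n} - S) u v)))"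

text \<open>Uniform distribution on a finite set; Dirac mass at 0 on the empty set.\<close>
definition unif0 :: "nat set \<Rightarrow> nat pmf" where
  "unif0 S = (if S = {} then return_pmf 0 else pmf_of_set S)"

text \<open>Conditional law of (Y_1,...,Y_l) given X = A.\<close>
fun Ys :: "nat \<Rightarrow> nat set \<Rightarrow> nat \<Rightarrow> nat list pmf" where
  "Ys k A 0 = return_pmf []"
| "Ys k A (Suc l) = bind_pmf (Ys k A l)
     (\<lambda>ys. map_pmf (\<lambda>y. ys @ [y]) (unif0 (A - ({1..k} \<union> set ys))))"

text \<open>Joint law of (X, (Y_1,...,Y_k)).\<close>
definition joint :: "nat \<Rightarrow> nat set pmf \<Rightarrow> (nat set \<times> nat list) pmf" where
  "joint k X = bind_pmf X (\<lambda>A. map_pmf (\<lambda>ys. (A, ys)) (Ys k A k))"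

text \<open>Generator of G_l: G_0 trivial, G_l = sigma(X_1..X_l) for l \<le> k,
  G_{k+r} = sigma(X_1..X_k, Y_1..Y_r).\<close>
definition gen :: "nat \<Rightarrow> nat \<Rightarrow> nat set \<times> nat list \<Rightarrow> nat set \<times> nat list" where
  "gen k l \<omega> = (fst \<omega> \<inter> {1..min l k}, take (l - k) (snd \<omega>))"

text \<open>Conditional expectation given sigma(g) on a discrete space, evaluated at outcome \<omega>.\<close>
definition cond_exp_pmf :: "'a pmf \<Rightarrow> ('a \<Rightarrow> 'b) \<Rightarrow> ('a \<Rightarrow> 'c::{banach,second_countable_topology}) \<Rightarrow> 'a \<Rightarrow> 'c" where
  "cond_exp_pmf p g Z \<omega> = measure_pmf.expectation (cond_pmf p {\<omega>'. g \<omega>' = g \<omega>}) Z"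

definition mart_diff :: "(nat set \<Rightarrow> complex^'d^'d) \<Rightarrow> nat \<Rightarrow> nat set pmf \<Rightarrow> nat \<Rightarrow> nat set \<times> nat list \<Rightarrow> complex^'d^'d" where
  "mart_diff f k X l \<omega> =
     cond_exp_pmf (joint k X) (gen k l) (\<lambda>\<omega>'. f (fst \<omega>')) \<omega>
   - cond_exp_pmf (joint k X) (gen k (l - 1)) (\<lambda>\<omega>'. f (fst \<omega>')) \<omega>"

end

theory Submission
  imports Defs
begin

text \<open>Given X = A, the indices Y_1, Y_2, ... are drawn uniformly without replacement from
  A - {1..k}, and the likelihood of a sequence of draws depends on A only through
  card (A - {1..k}), which G_k already determines, and through whether A contains the draws.
  Hence conditioning on G_l is the same as conditioning X on its coordinates in a set of
  revealed coordinates: X_1, ..., X_min(l,k), and the drawn Y's, all of which are 1.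
  Passing from G_(l-1) to G_l reveals at most one new coordinate a, and every unrevealed
  coordinate j has alpha_j <= alpha_min(l,k). The new conditional expectation of f(X) is one of
  the conditional expectations given X_a = 0 resp. X_a = 1, and the old one is a convex
  combination of both, so N_l is bounded in operator norm by their distance. The stochastic
  covering property couples the two conditional laws so that coupled configurations differ
  in a and in exactly one further unrevealed coordinate (by homogeneity they cannot differ in
  a alone), so the Lipschitz condition bounds that distance by 2 alpha_min(l,k). Finally, a
  Hermitian N with operator norm at most b satisfies N^2 <= b^2 I.\<close>

section \<open>Operator norm and Hermitian matrices\<close>

lemma norm_mult_le_op_norm: "norm (M *v v) \<le> op_norm M * norm v"
  unfolding op_norm_def by (rule onorm) simp

lemma op_norm_nonneg: "0 \<le> op_norm M"
  unfolding op_norm_def by (rule onorm_pos_le) simp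

lemma op_norm_zero [simp]: "op_norm 0 = 0"
proof -
  have "(*v) (0 :: complex^'d^'d) = (\<lambda>v. 0)"
    by (simp add: fun_eq_iff)
  then show ?thesis
    by (simp add: op_norm_def onorm_zero)
qed

lemma scaleR_matrix_vector_mult: "(c *\<^sub>R M) *v v = c *\<^sub>R (M *v (v :: 'a::real_algebra_1^'n))"
  by (simp add: vec_eq_iff matrix_vector_mult_def scaleR_sum_right)

lemma op_norm_scaleR: "op_norm (c *\<^sub>R M) = \<bar>c\<bar> * op_norm M"
proof -
  have "(\<lambda>v. (c *\<^sub>R M) *v v) = (\<lambda>v. c *\<^sub>R (M *v v))"
    by (simp add: scaleR_matrix_vector_mult)
  then show ?thesis unfolding op_norm_def by (simp add: onorm_scaleR)
qed

lemma op_norm_minus_commute: "op_norm (A - B) = op_norm (B - A)"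
proof -
  have "(\<lambda>v. (A - B) *v v) = (\<lambda>v. - ((B - A) *v v))"
    by (simp add: matrix_vector_mult_diff_rdistrib)
  then show ?thesis unfolding op_norm_def by (metis onorm_neg)
qed

lemma bounded_linear_matrix_vector_mult_left:
  "bounded_linear (\<lambda>M :: 'a::{euclidean_space,real_algebra_1}^'n^'m. M *v v)"
  by (auto simp: linear_conv_bounded_linear[symmetric] intro!: linearI
       simp: matrix_vector_mult_add_rdistrib scaleR_matrix_vector_mult)

lemma op_norm_expectation_le:
  fixes D :: "'a \<Rightarrow> complex^'d^'d"
  assumes "finite (set_pmf Q)" and "\<And>w. w \<in> set_pmf Q \<Longrightarrow> op_norm (D w) \<le> b"
  shows "op_norm (measure_pmf.expectation Q D) \<le> b"
  unfolding op_norm_def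
proof (rule onorm_le)
  fix v :: "complex^'d"
  have "measure_pmf.expectation Q D *v v = measure_pmf.expectation Q (\<lambda>w. D w *v v)"
    using integral_bounded_linear[OF bounded_linear_matrix_vector_mult_left
        integrable_measure_pmf_finite[OF assms(1), of D]] by simp
  also have "norm \<dots> \<le> measure_pmf.expectation Q (\<lambda>w. norm (D w *v v))"
    by (rule integral_norm_bound)
  also have "\<dots> \<le> measure_pmf.expectation Q (\<lambda>w. b * norm v)"
  proof (rule integral_mono_AE)
    show "AE w in Q. norm (D w *v v) \<le> b * norm v"
      using order_trans[OF norm_mult_le_op_norm mult_right_mono[OF assms(2) norm_ge_zero]]
      by (simp add: AE_measure_pmf_iff)
  qed (use assms(1) in \<open>auto intro: integrable_measure_pmf_finite\<close>)
  finally show "norm (measure_pmf.expectation Q D *v v) \<le> b * norm v" by simp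
qed

lemma op_norm_expectation_coupling_le:
  fixes g h :: "'a \<Rightarrow> complex^'d^'d"
  assumes "finite (set_pmf P)" "finite (set_pmf Q)"
    and "map_pmf fst c = P" "map_pmf snd c = Q"
    and "\<And>u v. (u, v) \<in> set_pmf c \<Longrightarrow> op_norm (g u - h v) \<le> b"
  shows "op_norm (measure_pmf.expectation P g - measure_pmf.expectation Q h) \<le> b"
proof -
  have "set_pmf c \<subseteq> set_pmf P \<times> set_pmf Q"
    using assms(3,4) by force
  then have fin: "finite (set_pmf c)"
    using assms(1,2) by (rule finite_subset[OF _ finite_cartesian_product])
  have "measure_pmf.expectation P g - measure_pmf.expectation Q h
      = measure_pmf.expectation c (\<lambda>w. g (fst w)) - measure_pmf.expectation c (\<lambda>w. h (snd w))"
    by (simp flip: assms(3,4))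
  also have "\<dots> = measure_pmf.expectation c (\<lambda>w. g (fst w) - h (snd w))"
    using fin by (simp add: integrable_measure_pmf_finite)
  finally show ?thesis
    using fin assms(5) by (auto intro: op_norm_expectation_le)
qed

definition adjoint_mat :: "complex^'d^'d \<Rightarrow> complex^'d^'d" where
  "adjoint_mat A = (\<chi> i j. cnj (A $ j $ i))"

lemma hermitian_mat_iff_adjoint: "hermitian_mat A \<longleftrightarrow> adjoint_mat A = A"
  unfolding hermitian_mat_def adjoint_mat_def vec_eq_iff vec_lambda_beta by metis

lemma bounded_linear_adjoint_mat: "bounded_linear adjoint_mat"
  by (auto simp: linear_conv_bounded_linear[symmetric] adjoint_mat_def vec_eq_iff intro!: linearI)

lemma hermitian_mat_diff: "hermitian_mat A \<Longrightarrow> hermitian_mat B \<Longrightarrow> hermitian_mat (A - B)"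
  by (simp add: hermitian_mat_iff_adjoint linear_diff[OF bounded_linear.linear[OF bounded_linear_adjoint_mat]])

lemma hermitian_mat_expectation:
  assumes "finite (set_pmf Q)" and "\<And>w. w \<in> set_pmf Q \<Longrightarrow> hermitian_mat (D w)"
  shows "hermitian_mat (measure_pmf.expectation Q D)"
proof -
  have "adjoint_mat (measure_pmf.expectation Q D) = measure_pmf.expectation Q (\<lambda>w. adjoint_mat (D w))"
    by (rule integral_bounded_linear[symmetric, OF bounded_linear_adjoint_mat])
       (rule integrable_measure_pmf_finite[OF assms(1)])
  also have "\<dots> = measure_pmf.expectation Q D"
    using assms(2) by (intro integral_cong_AE) (auto simp: AE_measure_pmf_iff hermitian_mat_iff_adjoint)
  finally show ?thesis by (simp add: hermitian_mat_iff_adjoint)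
qed

lemma hermitian_mat_inner_swap:
  fixes N :: "complex^'d^'d"
  assumes "hermitian_mat N"
  shows "(\<Sum>i\<in>UNIV. cnj (v $ i) * (N *v w) $ i) = (\<Sum>j\<in>UNIV. cnj ((N *v v) $ j) * w $ j)"
proof -
  have N: "\<And>i j. cnj (N $ j $ i) = N $ i $ j"
    using assms unfolding hermitian_mat_def by (metis complex_cnj_cnj)
  have "(\<Sum>i\<in>UNIV. cnj (v $ i) * (N *v w) $ i) = (\<Sum>i\<in>UNIV. \<Sum>j\<in>UNIV. cnj (v $ i) * N $ i $ j * w $ j)"
    by (simp add: matrix_vector_mult_def sum_distrib_left mult.assoc)
  also have "\<dots> = (\<Sum>j\<in>UNIV. \<Sum>i\<in>UNIV. cnj (v $ i) * N $ i $ j * w $ j)"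
    by (rule sum.swap)
  also have "\<dots> = (\<Sum>j\<in>UNIV. cnj ((N *v v) $ j) * w $ j)"
    by (simp add: matrix_vector_mult_def sum_distrib_right sum_distrib_left N mult.commute mult.left_commute)
  finally show ?thesis .
qed

lemma psd_le_square_if_op_norm_le:
  fixes N :: "complex^'d^'d"
  assumes herm: "hermitian_mat N" and bound: "op_norm N \<le> b"
  shows "psd_le (N ** N) (b\<^sup>2 *\<^sub>R mat 1)"
  unfolding psd_le_def psd_mat_def Let_def
proof
  fix v :: "complex^'d"
  define w where "w = N *v v"
  have eq: "(b\<^sup>2 *\<^sub>R mat 1 - N ** N) *v v = b\<^sup>2 *\<^sub>R v - N *v w"
    by (simp add: w_def matrix_vector_mult_diff_rdistrib scaleR_matrix_vector_mult matrix_vector_mul_assoc)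
  have "\<And>i. ((b\<^sup>2 *\<^sub>R mat 1 - N ** N) *v v) $ i = of_real (b\<^sup>2) * v $ i - (N *v w) $ i"
    unfolding eq vector_minus_component vector_scaleR_component by (simp add: scaleR_conv_of_real)
  then have "(\<Sum>i\<in>UNIV. cnj (v $ i) * ((b\<^sup>2 *\<^sub>R mat 1 - N ** N) *v v) $ i)
      = of_real (b\<^sup>2) * (\<Sum>i\<in>UNIV. cnj (v $ i) * v $ i) - (\<Sum>i\<in>UNIV. cnj (v $ i) * (N *v w) $ i)"
    by (simp add: sum_subtractf right_diff_distrib sum_distrib_left mult.left_commute del: of_real_power)
  also have "\<dots> = of_real (b\<^sup>2) * (\<Sum>i\<in>UNIV. of_real ((norm (v $ i))\<^sup>2))
      - (\<Sum>j\<in>UNIV. of_real ((norm (w $ j))\<^sup>2))"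
    by (simp add: hermitian_mat_inner_swap[OF herm] complex_norm_square mult.commute
        del: of_real_power flip: w_def)
  also have "\<dots> = of_real (b\<^sup>2 * (norm v)\<^sup>2 - (norm w)\<^sup>2)"
    by (simp add: norm_vec_def L2_set_def sum_nonneg)
  finally have q: "(\<Sum>i\<in>UNIV. cnj (v $ i) * ((b\<^sup>2 *\<^sub>R mat 1 - N ** N) *v v) $ i)
      = of_real (b\<^sup>2 * (norm v)\<^sup>2 - (norm w)\<^sup>2)" .
  have "norm w \<le> b * norm v"
    using order_trans[OF norm_mult_le_op_norm mult_right_mono[OF bound norm_ge_zero]] by (simp add: w_def)
  then have "(norm w)\<^sup>2 \<le> (b * norm v)\<^sup>2"
    by (simp add: power_mono)
  then show "Im (\<Sum>i\<in>UNIV. cnj (v $ i) * ((b\<^sup>2 *\<^sub>R mat 1 - N ** N) *v v) $ i) = 0 \<and>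
      0 \<le> Re (\<Sum>i\<in>UNIV. cnj (v $ i) * ((b\<^sup>2 *\<^sub>R mat 1 - N ** N) *v v) $ i)"
    unfolding q by (simp add: power_mult_distrib)
qed

section \<open>Conditioning finite distributions\<close>

lemma pmf_bind_map_inj:
  assumes "\<And>x y x' y'. h x y = h x' y' \<Longrightarrow> x = x' \<and> y = y'"
  shows "pmf (bind_pmf M (\<lambda>x. map_pmf (h x) (U x))) (h x0 y0) = pmf M x0 * pmf (U x0) y0"
proof -
  have "pmf (map_pmf (h x) (U x)) (h x0 y0) = indicator {x0} x * pmf (U x0) y0" for x
  proof (cases "x = x0")
    case True
    have "inj (h x0)" using assms by (auto intro: injI)
    then show ?thesis using True by (simp add: pmf_map_inj')
  next
    case False
    then have "h x0 y0 \<notin> h x ` set_pmf (U x)" using assms by blast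
    then show ?thesis using False by (simp add: pmf_map_outside)
  qed
  then show ?thesis
    by (simp add: pmf_bind measure_pmf_single)
qed

lemma pmf_eq_if_proportional:
  assumes "\<And>x. pmf M x = c * pmf N x" and "0 \<le> c"
  shows "M = N"
proof -
  have "emeasure (measure_pmf M) UNIV = (\<integral>\<^sup>+ x. ennreal (pmf M x) \<partial>count_space UNIV)"
    by (simp add: nn_integral_pmf)
  also have "\<dots> = (\<integral>\<^sup>+ x. ennreal c * ennreal (pmf N x) \<partial>count_space UNIV)"
    using assms by (simp add: ennreal_mult)
  also have "\<dots> = ennreal c * emeasure (measure_pmf N) UNIV"
    by (simp add: nn_integral_cmult nn_integral_pmf)
  finally have "c = 1"
    using assms(2) by (simp add: ennreal_eq_1)
  then show ?thesis
    using assms(1) by (intro pmf_eqI) simp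
qed

lemma cond_pmf_cong_set_pmf:
  assumes "set_pmf p \<inter> E \<noteq> {}" and "set_pmf p \<inter> E = set_pmf p \<inter> E'"
  shows "cond_pmf p E = cond_pmf p E'"
proof (rule pmf_eqI)
  have "measure p E = measure p E'"
    using assms(2) measure_Int_set_pmf[of p E] measure_Int_set_pmf[of p E'] by (simp add: Int_commute)
  then show "pmf (cond_pmf p E) x = pmf (cond_pmf p E') x" for x
    using assms by (auto simp: pmf_cond pmf_eq_0_set_pmf)
qed

lemma pmf_map_pmf_Pair_const:
  "pmf (map_pmf (\<lambda>x. (x, c)) M) (x, y) = (if y = c then pmf M x else 0)"
proof (cases "y = c")
  case True
  have "inj (\<lambda>x. (x, c))"
    by (auto intro: injI)
  then show ?thesis
    using True pmf_map_inj' by metis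
qed (auto intro: pmf_map_outside)

text \<open>Bayes' rule: if, among the A with P A, the likelihood of observing y0 is proportional
  to the indicator of Q, then observing y0 just restricts A to Q.\<close>
lemma map_fst_cond_pmf_bind_pair:
  fixes p :: "'a pmf" and K :: "'a \<Rightarrow> 'b pmf"
  assumes A0: "A0 \<in> set_pmf p" "P A0" "y0 \<in> set_pmf (K A0)"
    and likelihood: "\<And>A. A \<in> set_pmf p \<Longrightarrow> P A \<Longrightarrow> pmf (K A) y0 = C * (if Q A then 1 else 0)"
  shows "map_pmf fst (cond_pmf (bind_pmf p (\<lambda>A. map_pmf (Pair A) (K A))) {w. P (fst w) \<and> snd w = y0})
         = cond_pmf p {A. P A \<and> Q A}"
proof -
  define J where "J = bind_pmf p (\<lambda>A. map_pmf (Pair A) (K A))"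
  define E where "E = {w. P (fst w) \<and> snd w = y0}"
  define PQ where "PQ = {A. P A \<and> Q A}"
  have pmf_J: "pmf J (A, y) = pmf p A * pmf (K A) y" for A y
    unfolding J_def by (rule pmf_bind_map_inj[where h=Pair]) simp
  have "pmf (K A0) y0 > 0"
    using A0(3) by (simp add: pmf_positive)
  then have "C > 0" "Q A0" "(A0, y0) \<in> set_pmf J"
    using likelihood[OF A0(1,2)] A0(1) by (auto simp: set_pmf_iff pmf_J split: if_splits)
  then have J_E: "set_pmf J \<inter> E \<noteq> {}" "measure J E > 0"
    and p_PQ: "set_pmf p \<inter> PQ \<noteq> {}" "measure p PQ > 0"
    using A0 by (auto simp: E_def PQ_def intro!: measure_pmf_posI)
  have "cond_pmf J E = map_pmf (\<lambda>A. (A, y0)) (cond_pmf p PQ)"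
  proof (rule pmf_eq_if_proportional)
    show "0 \<le> C * measure p PQ / measure J E"
      using \<open>C > 0\<close> by simp
    fix w :: "'a \<times> 'b"
    obtain A y where w: "w = (A, y)" by (cases w)
    show "pmf (cond_pmf J E) w = C * measure p PQ / measure J E * pmf (map_pmf (\<lambda>A. (A, y0)) (cond_pmf p PQ)) w"
    proof (cases "w \<in> E \<and> A \<in> set_pmf p")
      case True
      then have "y = y0" "P A" "A \<in> PQ \<longleftrightarrow> Q A"
        by (auto simp: w E_def PQ_def)
      then show ?thesis
        using True likelihood[of A] J_E(2) p_PQ(2)
        by (cases "Q A") (simp_all add: w pmf_map_pmf_Pair_const pmf_cond[OF J_E(1)] pmf_cond[OF p_PQ(1)] pmf_J)
    next
      case False
      have "pmf (cond_pmf J E) w = 0"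
        using False by (cases "w \<in> E") (simp_all add: w pmf_cond[OF J_E(1)] pmf_J pmf_eq_0_set_pmf)
      moreover have "A \<notin> set_pmf (cond_pmf p PQ)" if "y = y0"
        using False that p_PQ(1) by (auto simp: w E_def PQ_def)
      ultimately show ?thesis
        by (auto simp: w pmf_map_pmf_Pair_const set_pmf_iff)
    qed
  qed
  then show ?thesis
    by (simp add: pmf.map_comp o_def J_def E_def PQ_def)
qed

lemma expectation_cond_pmf_split:
  fixes f :: "'a \<Rightarrow> 'b::{banach, second_countable_topology}"
  assumes fin: "finite (set_pmf p)"
    and ne1: "set_pmf p \<inter> (B \<inter> C) \<noteq> {}" and ne0: "set_pmf p \<inter> (B - C) \<noteq> {}"
  obtains q where "0 \<le> q" "q \<le> 1"
    "measure_pmf.expectation (cond_pmf p (B \<inter> C)) f - measure_pmf.expectation (cond_pmf p B) f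
     = q *\<^sub>R (measure_pmf.expectation (cond_pmf p (B \<inter> C)) f - measure_pmf.expectation (cond_pmf p (B - C)) f)"
proof
  define m1 where "m1 = measure p (B \<inter> C)"
  define m0 where "m0 = measure p (B - C)"
  let ?E = "\<lambda>E. measure_pmf.expectation (cond_pmf p E) f"
  have ne: "set_pmf p \<inter> B \<noteq> {}"
    using ne1 by auto
  have "m1 > 0" "m0 > 0"
    using ne1 ne0 by (auto simp: m1_def m0_def intro: measure_pmf_posI)
  have "measure p ((B \<inter> C) \<union> (B - C)) = m1 + m0"
    unfolding m1_def m0_def by (rule measure_pmf.finite_measure_Union) auto
  then have m: "measure p B = m1 + m0"
    by (simp add: Int_Diff_Un)
  have pmf_B: "pmf (cond_pmf p B) a
      = (m1 / measure p B) * pmf (cond_pmf p (B \<inter> C)) a + (m0 / measure p B) * pmf (cond_pmf p (B - C)) a" for a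
    using \<open>m1 > 0\<close> \<open>m0 > 0\<close>
    by (simp add: pmf_cond[OF ne] pmf_cond[OF ne1] pmf_cond[OF ne0] m1_def m0_def)
  have sum: "?E E = (\<Sum>a\<in>set_pmf p. pmf (cond_pmf p E) a *\<^sub>R f a)" if "set_pmf p \<inter> E \<noteq> {}" for E
    using that by (intro integral_measure_pmf[OF fin]) auto
  have "?E B = (m1 / measure p B) *\<^sub>R ?E (B \<inter> C) + (m0 / measure p B) *\<^sub>R ?E (B - C)"
    by (simp add: sum[OF ne] sum[OF ne1] sum[OF ne0] pmf_B scaleR_add_left sum.distrib scaleR_sum_right)
  then show "?E (B \<inter> C) - ?E B = (m0 / measure p B) *\<^sub>R (?E (B \<inter> C) - ?E (B - C))"
    using \<open>m1 > 0\<close> \<open>m0 > 0\<close> by (simp add: m algebra_simps add_divide_distrib[symmetric] flip: scaleR_add_left)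
  show "0 \<le> m0 / measure p B" "m0 / measure p B \<le> 1"
    using \<open>m1 > 0\<close> \<open>m0 > 0\<close> by (simp_all add: m)
qed

section \<open>The revealed coordinates\<close>

lemma set_pmf_unif0: "finite S \<Longrightarrow> set_pmf (unif0 S) = (if S = {} then {0} else S)"
  by (simp add: unif0_def)

lemma pmf_unif0: "finite S \<Longrightarrow> S \<noteq> {} \<Longrightarrow> pmf (unif0 S) y = indicator S y / card S"
  by (simp add: unif0_def pmf_of_set)

lemma length_Ys: "ys \<in> set_pmf (Ys k A r) \<Longrightarrow> length ys = r"
  by (induction r arbitrary: ys) auto

lemma pmf_Ys_snoc:
  "pmf (Ys k A (Suc r)) (ys @ [y]) = pmf (Ys k A r) ys * pmf (unif0 (A - ({1..k} \<union> set ys))) y"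
  unfolding Ys.simps by (rule pmf_bind_map_inj) simp

lemma set_pmf_Ys:
  assumes "finite A" and "ys \<in> set_pmf (Ys k A r)"
  shows "set ys \<subseteq> insert 0 (A - {1..k}) \<and> card (A - ({1..k} \<union> set ys)) = card (A - {1..k}) - r"
  using assms(2)
proof (induction r arbitrary: ys)
  case (Suc r)
  then obtain ys' y where ys: "ys = ys' @ [y]" and ys': "ys' \<in> set_pmf (Ys k A r)"
    and y: "y \<in> set_pmf (unif0 (A - ({1..k} \<union> set ys')))"
    by auto
  define R where "R = A - ({1..k} \<union> set ys')"
  have IH: "set ys' \<subseteq> insert 0 (A - {1..k})" "card R = card (A - {1..k}) - r"
    using Suc.IH[OF ys'] by (simp_all add: R_def)
  have "finite R"
    using assms(1) by (simp add: R_def)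
  show ?case
  proof (cases "R = {}")
    case True
    then have "y = 0" and empty: "A - ({1..k} \<union> set ys) = {}"
      using y \<open>finite R\<close> by (auto simp: set_pmf_unif0 R_def ys)
    then show ?thesis
      unfolding empty using IH True by (simp add: ys)
  next
    case False
    then have "y \<in> R"
      using y \<open>finite R\<close> by (simp add: set_pmf_unif0 R_def)
    moreover have "A - ({1..k} \<union> set ys) = R - {y}"
      by (auto simp: ys R_def)
    ultimately show ?thesis
      using IH \<open>finite R\<close> by (auto simp: ys R_def)
  qed
qed simp

lemma map_take_Ys: "r \<le> l \<Longrightarrow> map_pmf (take r) (Ys k A l) = Ys k A r"
proof (induction l)
  case (Suc l)
  show ?case
  proof (cases "r = Suc l")
    case True
    then have "map_pmf (take r) (Ys k A (Suc l)) = map_pmf id (Ys k A (Suc l))"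
      by (intro map_pmf_cong) (auto dest: length_Ys)
    then show ?thesis
      using True by simp
  next
    case False
    then have "r \<le> l"
      using Suc.prems by simp
    have "map_pmf (take r) (Ys k A (Suc l)) = bind_pmf (Ys k A l) (\<lambda>ys. return_pmf (take r ys))"
      unfolding Ys.simps map_bind_pmf
      using \<open>r \<le> l\<close> by (intro bind_pmf_cong) (auto simp: pmf.map_comp o_def dest!: length_Ys)
    also have "\<dots> = Ys k A r"
      using Suc.IH[OF \<open>r \<le> l\<close>] by (simp add: map_pmf_def)
    finally show ?thesis .
  qed
qed simp

lemma take_in_set_pmf_Ys: "ys \<in> set_pmf (Ys k A l) \<Longrightarrow> r \<le> l \<Longrightarrow> take r ys \<in> set_pmf (Ys k A r)"
  by (metis map_take_Ys set_map_pmf imageI)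

lemma pmf_unif0_Diff_eq_indicator:
  assumes "finite A" "finite A0" "0 \<notin> A0" "card (A - K) = card (A0 - K)"
    and "y \<in> set_pmf (unif0 (A0 - K))"
  shows "pmf (unif0 (A - K)) y = pmf (unif0 (A0 - K)) y * (if y = 0 \<or> y \<in> A then 1 else 0)"
proof (cases "A0 - K = {}")
  case True
  then have "card (A - K) = 0" "y = 0"
    using assms(2,4,5) by (simp_all add: set_pmf_unif0)
  then have "A - K = {}"
    using assms(1) by (metis card_0_eq finite_Diff)
  then show ?thesis
    using True \<open>y = 0\<close> by (simp add: unif0_def)
next
  case False
  then have y: "y \<in> A0 - K" and "card (A - K) \<noteq> 0"
    using assms(2,4,5) by (simp_all add: set_pmf_unif0)
  then have "A - K \<noteq> {}"
    by (metis card.empty)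
  moreover have "y \<noteq> 0"
    using y assms(3) by (metis DiffD1)
  ultimately show ?thesis
    using False y assms(1,2,4) by (simp add: pmf_unif0 indicator_def)
qed

lemma pmf_Ys_eq_indicator:
  assumes "finite A" "finite A0" "0 \<notin> A0" "card (A - {1..k}) = card (A0 - {1..k})"
  shows "ys \<in> set_pmf (Ys k A0 r) \<Longrightarrow>
    pmf (Ys k A r) ys = pmf (Ys k A0 r) ys * (if set ys - {0} \<subseteq> A then 1 else 0)"
proof (induction r arbitrary: ys)
  case (Suc r)
  then obtain t y where ys: "ys = t @ [y]" and t: "t \<in> set_pmf (Ys k A0 r)"
    and y: "y \<in> set_pmf (unif0 (A0 - ({1..k} \<union> set t)))"
    by auto
  have IH: "pmf (Ys k A r) t = pmf (Ys k A0 r) t * (if set t - {0} \<subseteq> A then 1 else 0)"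
    using Suc.IH[OF t] .
  show ?case
  proof (cases "set t - {0} \<subseteq> A")
    case False
    then show ?thesis
      by (simp only: ys pmf_Ys_snoc IH) auto
  next
    case True
    then have "t \<in> set_pmf (Ys k A r)"
      using IH t by (simp add: set_pmf_iff)
    then have "card (A - ({1..k} \<union> set t)) = card (A0 - ({1..k} \<union> set t))"
      using set_pmf_Ys[OF assms(1)] set_pmf_Ys[OF assms(2) t] assms(4) by simp
    note unif0_eq = pmf_unif0_Diff_eq_indicator[OF assms(1-3) this y]
    have "set ys - {0} \<subseteq> A \<longleftrightarrow> y = 0 \<or> y \<in> A"
      using True by (auto simp: ys)
    then show ?thesis
      using True by (simp only: ys pmf_Ys_snoc IH unif0_eq) simp
  qed
qed simp

lemma pmf_Ys_eq_indicator_if_agree: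
  assumes X_range: "set_pmf X \<subseteq> Pow {1..n}" and X_hom: "\<forall>A\<in>set_pmf X. card A = k"
    and "A \<in> set_pmf X" "A0 \<in> set_pmf X" "A \<inter> {1..min l k} = A0 \<inter> {1..min l k}"
    and ys: "ys \<in> set_pmf (Ys k A0 (l - k))"
  shows "pmf (Ys k A (l - k)) ys = pmf (Ys k A0 (l - k)) ys * (if set ys - {0} \<subseteq> A then 1 else 0)"
proof (cases "l \<le> k")
  case False
  then have "A \<inter> {1..k} = A0 \<inter> {1..k}"
    using assms(5) by (simp add: min_def)
  moreover have "A \<subseteq> {1..n}" "A0 \<subseteq> {1..n}"
    using assms(3,4) X_range by auto
  then have "finite A" "finite A0" "0 \<notin> A0"
    by (auto intro: finite_subset)
  ultimately have "card (A - {1..k}) = card (A0 - {1..k})"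
    using assms(3,4) X_hom by (simp add: card_Diff_subset_Int)
  then show ?thesis
    using pmf_Ys_eq_indicator[OF \<open>finite A\<close> \<open>finite A0\<close> \<open>0 \<notin> A0\<close> _ ys] by simp
qed (use ys in auto)

lemma map_pmf_joint_take:
  assumes "r \<le> k"
  shows "map_pmf (\<lambda>\<omega>. (fst \<omega>, take r (snd \<omega>))) (joint k X) = bind_pmf X (\<lambda>A. map_pmf (Pair A) (Ys k A r))"
  unfolding joint_def map_bind_pmf
  by (intro bind_pmf_cong) (simp_all add: pmf.map_comp o_def flip: map_take_Ys[OF assms])

text \<open>The coordinates of X known at time l: X_1, ..., X_l while l \<le> k, then additionally
  the indices Y_1, ..., Y_(l-k) drawn so far (the dummy value 0 reveals nothing).\<close>
definition revealed :: "nat \<Rightarrow> nat \<Rightarrow> nat list \<Rightarrow> nat set" where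
  "revealed k l ys = {1..min l k} \<union> (set (take (l - k) ys) - {0})"

lemma revealed_Suc:
  assumes "length ys = k" "l < 2 * k"
  shows "revealed k (Suc l) ys = revealed k l ys \<union> (if l < k then {Suc l} else {ys ! (l - k)} - {0})"
proof (cases "l < k")
  case True
  then show ?thesis
    by (auto simp: revealed_def min_def)
next
  case False
  then have "Suc l - k = Suc (l - k)" "l - k < length ys"
    using assms by auto
  then show ?thesis
    using False by (auto simp: revealed_def min_def take_Suc_conv_app_nth)
qed

lemma min_Suc_le_if_not_revealed: "1 \<le> j \<Longrightarrow> j \<notin> revealed k m ys \<Longrightarrow> min (Suc m) k \<le> j"
  by (auto simp: revealed_def)

lemma revealed_subset:
  assumes "A \<subseteq> {1..n}" "card A = k" "ys \<in> set_pmf (Ys k A k)"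
  shows "revealed k m ys \<subseteq> {1..n}"
proof -
  have "finite A"
    using assms(1) by (rule finite_subset) simp
  then have "k \<le> n" "set ys \<subseteq> insert 0 A"
    using card_mono[OF _ assms(1)] assms(2) set_pmf_Ys[OF _ assms(3)] by auto
  then show ?thesis
    using assms(1) set_take_subset[of "m - k" ys] by (auto simp: revealed_def)
qed

lemma revealed_Suc_cases:
  assumes "A \<subseteq> {1..n}" "card A = k" "ys \<in> set_pmf (Ys k A k)" "m < 2 * k"
  shows "revealed k (Suc m) ys = revealed k m ys \<or>
    (\<exists>a\<in>{1..n}. revealed k (Suc m) ys = insert a (revealed k m ys))"
proof -
  have "finite A"
    using assms(1) by (rule finite_subset) simp
  then have "k \<le> n" "set ys \<subseteq> insert 0 A" "length ys = k"
    using card_mono[OF _ assms(1)] assms(2) set_pmf_Ys[OF _ assms(3)] length_Ys[OF assms(3)] by auto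
  note revealed_Suc = revealed_Suc[OF \<open>length ys = k\<close> assms(4)]
  show ?thesis
  proof (cases "m < k")
    case True
    then have "revealed k (Suc m) ys = insert (Suc m) (revealed k m ys)"
      by (simp add: revealed_Suc)
    then show ?thesis
      using True \<open>k \<le> n\<close> by auto
  next
    case False
    define y where "y = ys ! (m - k)"
    have "y \<in> set ys"
      using False assms(4) \<open>length ys = k\<close> by (simp add: y_def)
    have eq: "revealed k (Suc m) ys = revealed k m ys \<union> ({y} - {0})"
      using False by (simp add: revealed_Suc y_def)
    show ?thesis
    proof (cases "y = 0")
      case False
      then have "y \<in> {1..n}"
        using \<open>y \<in> set ys\<close> \<open>set ys \<subseteq> insert 0 A\<close> assms(1) by auto
      then show ?thesis
        using eq False by auto
    qed (simp add: eq)
  qed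
qed

lemma map_fst_cond_pmf_joint_gen:
  assumes X_range: "set_pmf X \<subseteq> Pow {1..n}" and X_hom: "\<forall>A\<in>set_pmf X. card A = k"
    and \<omega>: "(A0, ys0) \<in> set_pmf (joint k X)" and "l \<le> 2 * k"
  shows "map_pmf fst (cond_pmf (joint k X) {\<omega>'. gen k l \<omega>' = gen k l (A0, ys0)})
       = cond_pmf X {A. A \<inter> revealed k l ys0 = A0 \<inter> revealed k l ys0}"
proof -
  have A0: "A0 \<in> set_pmf X" and ys0: "ys0 \<in> set_pmf (Ys k A0 k)"
    using \<omega> by (auto simp: joint_def)
  define r where "r = l - k"
  have "r \<le> k"
    using assms(4) by (simp add: r_def)
  define h where "h = (\<lambda>\<omega> :: nat set \<times> nat list. (fst \<omega>, take r (snd \<omega>)))"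
  define P where "P = (\<lambda>A. A \<inter> {1..min l k} = A0 \<inter> {1..min l k})"
  define y0 where "y0 = take r ys0"
  define E where "E = {w :: nat set \<times> nat list. P (fst w) \<and> snd w = y0}"
  have y0: "y0 \<in> set_pmf (Ys k A0 r)"
    unfolding y0_def using ys0 \<open>r \<le> k\<close> by (rule take_in_set_pmf_Ys)
  have gen_eq: "{\<omega>'. gen k l \<omega>' = gen k l (A0, ys0)} = h -` E"
    by (auto simp: gen_def h_def E_def P_def y0_def r_def)
  have "set_pmf (joint k X) \<inter> h -` E \<noteq> {}"
    using \<omega> by (auto simp: h_def E_def P_def y0_def)
  then have "map_pmf fst (cond_pmf (joint k X) (h -` E)) = map_pmf fst (cond_pmf (map_pmf h (joint k X)) E)"
    by (simp add: cond_map_pmf pmf.map_comp o_def h_def)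
  also have "\<dots> = cond_pmf X {A. P A \<and> set y0 - {0} \<subseteq> A}"
    unfolding h_def map_pmf_joint_take[OF \<open>r \<le> k\<close>] E_def
    using pmf_Ys_eq_indicator_if_agree[OF X_range X_hom _ A0 _ y0[unfolded r_def]]
    by (intro map_fst_cond_pmf_bind_pair[where K="\<lambda>A. Ys k A r" and P=P and
          C="pmf (Ys k A0 r) y0" and Q="\<lambda>A. set y0 - {0} \<subseteq> A", OF A0 _ y0])
       (simp_all add: P_def r_def)
  also have "{A. P A \<and> set y0 - {0} \<subseteq> A} = {A. A \<inter> revealed k l ys0 = A0 \<inter> revealed k l ys0}"
  proof -
    have "set y0 - {0} \<subseteq> A0"
      using set_pmf_Ys[OF _ y0] A0 X_range by (auto intro: finite_subset)
    then show ?thesis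
      by (auto simp: P_def revealed_def y0_def r_def)
  qed
  finally show ?thesis
    by (simp only: gen_eq)
qed

lemma cond_exp_joint_eq_revealed:
  assumes "set_pmf X \<subseteq> Pow {1..n}" "\<forall>A\<in>set_pmf X. card A = k"
    and "(A0, ys0) \<in> set_pmf (joint k X)" "l \<le> 2 * k"
  shows "cond_exp_pmf (joint k X) (gen k l) (\<lambda>\<omega>'. f (fst \<omega>')) (A0, ys0) =
    measure_pmf.expectation (cond_pmf X {A. A \<inter> revealed k l ys0 = A0 \<inter> revealed k l ys0}) f"
  unfolding cond_exp_pmf_def map_fst_cond_pmf_joint_gen[OF assms, symmetric] by simp

section \<open>Revealing one coordinate under stochastic covering\<close>

lemma set_pmf_cond_law_compl:
  assumes "z \<subseteq> S" and "set_pmf X \<inter> {A. A \<inter> S = z} \<noteq> {}"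
  shows "set_pmf (cond_law_compl X S z) = {u. u \<inter> S = {} \<and> u \<union> z \<in> set_pmf X}"
proof -
  have "u \<in> (\<lambda>A. A - S) ` (set_pmf X \<inter> {A. A \<inter> S = z}) \<longleftrightarrow> u \<inter> S = {} \<and> u \<union> z \<in> set_pmf X" for u
  proof
    assume "u \<inter> S = {} \<and> u \<union> z \<in> set_pmf X"
    then show "u \<in> (\<lambda>A. A - S) ` (set_pmf X \<inter> {A. A \<inter> S = z})"
      using assms(1) by (intro image_eqI[of _ _ "u \<union> z"]) auto
  qed (auto simp: Un_Diff_Int)
  then show ?thesis
    using assms(2) by (auto simp: cond_law_compl_def)
qed

lemma expectation_cond_law_compl:
  fixes g :: "nat set \<Rightarrow> 'b::{banach, second_countable_topology}"
  assumes "set_pmf X \<inter> {A. A \<inter> S = z} \<noteq> {}"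
  shows "measure_pmf.expectation (cond_law_compl X S z) (\<lambda>u. g (u \<union> z))
       = measure_pmf.expectation (cond_pmf X {A. A \<inter> S = z}) g"
  unfolding cond_law_compl_def integral_map_pmf
  using assms by (intro integral_cong_AE) (auto simp: AE_measure_pmf_iff Un_Diff_Int)

lemma stoch_coveringE:
  assumes "stoch_covering n X" "S \<subseteq> {1..n}" "z \<subseteq> S" "a \<in> S - z"
    and "set_pmf X \<inter> {A. A \<inter> S = z} \<noteq> {}" "set_pmf X \<inter> {A. A \<inter> S = insert a z} \<noteq> {}"
  obtains c where "map_pmf fst c = cond_law_compl X S z"
    "map_pmf snd c = cond_law_compl X S (insert a z)"
    "\<And>u v. (u, v) \<in> set_pmf c \<Longrightarrow> covers ({1..n} - S) u v"
proof -
  have S: "insert a z \<inter> S = insert a z" "z \<inter> S = z"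
    using assms(3,4) by auto
  have "\<exists>c :: (nat set \<times> nat set) pmf. map_pmf fst c = cond_law_compl X S (z \<inter> S) \<and>
      map_pmf snd c = cond_law_compl X S (insert a z \<inter> S) \<and>
      (\<forall>(u, v)\<in>set_pmf c. covers ({1..n} - S) u v)"
  proof (rule assms(1)[unfolded stoch_covering_def, rule_format], intro conjI)
    show "covers S (insert a z \<inter> S) (z \<inter> S)"
      using assms(4) by (auto simp: S covers_def)
  qed (use assms(2-6) in \<open>auto simp: S\<close>)
  then show ?thesis
    using that by (auto simp: S)
qed

lemma dist_alpha_insert_insert:
  assumes "i \<in> {1..n}" "a \<in> {1..n}" "i \<noteq> a" "i \<notin> B" "a \<notin> B"
  shows "dist_alpha n \<alpha> (insert i B) (insert a B) = \<alpha> i + \<alpha> a"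
proof -
  have "dist_alpha n \<alpha> (insert i B) (insert a B) = (\<Sum>j\<in>{1..n}. if j \<in> {i, a} then \<alpha> j else 0)"
    unfolding dist_alpha_def using assms(3-5) by (intro sum.cong) auto
  also have "\<dots> = sum \<alpha> ({1..n} \<inter> {i, a})"
    by (rule sum.inter_restrict[symmetric]) simp
  also have "{1..n} \<inter> {i, a} = {i, a}"
    using assms(1,2) by auto
  finally show ?thesis
    using assms(3) by simp
qed

lemma op_norm_diff_covering_le:
  fixes f :: "nat set \<Rightarrow> complex^'d^'d"
  assumes f_lip: "\<forall>x y. x \<subseteq> {1..n} \<longrightarrow> y \<subseteq> {1..n} \<longrightarrow> op_norm (f x - f y) \<le> dist_alpha n \<alpha> x y"
    and X_range: "set_pmf X \<subseteq> Pow {1..n}"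
    and X_hom: "\<forall>A\<in>set_pmf X. card A = k"
    and S: "z \<subseteq> S" "a \<in> {1..n} - S"
    and \<beta>: "\<forall>j\<in>{1..n} - S. \<alpha> j \<le> \<beta>"
    and u: "u \<inter> insert a S = {}" "u \<union> z \<in> set_pmf X"
    and v: "v \<inter> insert a S = {}" "v \<union> insert a z \<in> set_pmf X"
    and uv: "covers ({1..n} - insert a S) u v"
  shows "op_norm (f (u \<union> z) - f (v \<union> insert a z)) \<le> 2 * \<beta>"
proof -
  have sub: "u \<union> z \<subseteq> {1..n}" "v \<union> insert a z \<subseteq> {1..n}"
    using u(2) v(2) X_range by auto
  have "u \<noteq> v"
  proof
    assume "u = v"
    have "finite (u \<union> z)" "a \<notin> u \<union> z"
      using sub(1) u(1) S by (auto intro: finite_subset)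
    then have "card (insert a (u \<union> z)) = Suc (card (u \<union> z))"
      by simp
    moreover have "insert a (u \<union> z) = v \<union> insert a z"
      using \<open>u = v\<close> by auto
    ultimately show False
      using u(2) v(2) X_hom by auto
  qed
  then obtain i where i: "i \<in> {1..n} - insert a S" "i \<notin> v" "u = insert i v"
    using uv unfolding covers_def by blast
  have "dist_alpha n \<alpha> (insert i (v \<union> z)) (insert a (v \<union> z)) = \<alpha> i + \<alpha> a"
    using i S v(1) by (intro dist_alpha_insert_insert) auto
  moreover have "\<alpha> i \<le> \<beta>" "\<alpha> a \<le> \<beta>"
    using \<beta> i(1) S(2) by auto
  moreover have "op_norm (f (u \<union> z) - f (v \<union> insert a z)) \<le> dist_alpha n \<alpha> (u \<union> z) (v \<union> insert a z)"
    using f_lip sub by blast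
  ultimately show ?thesis
    by (simp add: i(3))
qed

lemma op_norm_cond_expectation_insert_le:
  fixes f :: "nat set \<Rightarrow> complex^'d^'d"
  assumes f_lip: "\<forall>x y. x \<subseteq> {1..n} \<longrightarrow> y \<subseteq> {1..n} \<longrightarrow> op_norm (f x - f y) \<le> dist_alpha n \<alpha> x y"
    and X_range: "set_pmf X \<subseteq> Pow {1..n}"
    and X_hom: "\<forall>A\<in>set_pmf X. card A = k"
    and X_scp: "stoch_covering n X"
    and S: "S \<subseteq> {1..n}" "z \<subseteq> S" "a \<in> {1..n} - S"
    and \<beta>: "\<forall>j\<in>{1..n} - S. \<alpha> j \<le> \<beta>"
    and ne0: "set_pmf X \<inter> {A. A \<inter> insert a S = z} \<noteq> {}"
    and ne1: "set_pmf X \<inter> {A. A \<inter> insert a S = insert a z} \<noteq> {}"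
  shows "op_norm (measure_pmf.expectation (cond_pmf X {A. A \<inter> insert a S = z}) f
               - measure_pmf.expectation (cond_pmf X {A. A \<inter> insert a S = insert a z}) f) \<le> 2 * \<beta>"
proof -
  have "insert a S \<subseteq> {1..n}" "z \<subseteq> insert a S" "a \<in> insert a S - z" "insert a z \<subseteq> insert a S"
    using S by auto
  note compl0 = set_pmf_cond_law_compl[OF \<open>z \<subseteq> insert a S\<close> ne0]
    and compl1 = set_pmf_cond_law_compl[OF \<open>insert a z \<subseteq> insert a S\<close> ne1]
  obtain c where c: "map_pmf fst c = cond_law_compl X (insert a S) z"
    "map_pmf snd c = cond_law_compl X (insert a S) (insert a z)"
    "\<And>u v. (u, v) \<in> set_pmf c \<Longrightarrow> covers ({1..n} - insert a S) u v"
    by (blast intro: stoch_coveringE[OF X_scp \<open>insert a S \<subseteq> {1..n}\<close> \<open>z \<subseteq> insert a S\<close> \<open>a \<in> insert a S - z\<close> ne0 ne1])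
  have "finite (set_pmf X)"
    using X_range by (rule finite_subset) simp
  then have fin0: "finite (set_pmf (cond_law_compl X (insert a S) z))"
    and fin1: "finite (set_pmf (cond_law_compl X (insert a S) (insert a z)))"
    using ne0 ne1 by (simp_all add: cond_law_compl_def)
  have "op_norm (f (u \<union> z) - f (v \<union> insert a z)) \<le> 2 * \<beta>" if uv: "(u, v) \<in> set_pmf c" for u v
  proof -
    have "u \<in> set_pmf (map_pmf fst c)" "v \<in> set_pmf (map_pmf snd c)"
      using uv by force+
    then have "u \<inter> insert a S = {}" "u \<union> z \<in> set_pmf X"
      and "v \<inter> insert a S = {}" "v \<union> insert a z \<in> set_pmf X"
      unfolding c(1,2) compl0 compl1 by simp_all
    then show ?thesis
      using op_norm_diff_covering_le[OF f_lip X_range X_hom S(2,3) \<beta> _ _ _ _ c(3)[OF uv]] by blast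
  qed
  then have "op_norm (measure_pmf.expectation (cond_law_compl X (insert a S) z) (\<lambda>u. f (u \<union> z))
      - measure_pmf.expectation (cond_law_compl X (insert a S) (insert a z)) (\<lambda>v. f (v \<union> insert a z)))
      \<le> 2 * \<beta>"
    by (rule op_norm_expectation_coupling_le[OF fin0 fin1 c(1,2)])
  then show ?thesis
    by (simp only: expectation_cond_law_compl[OF ne0, of f] expectation_cond_law_compl[OF ne1, of f])
qed

lemma op_norm_cond_expectation_Int_le:
  fixes f :: "'a \<Rightarrow> complex^'d^'d"
  assumes fin: "finite (set_pmf p)" and ne: "set_pmf p \<inter> (B \<inter> C) \<noteq> {}"
    and halves: "set_pmf p \<inter> (B - C) \<noteq> {} \<Longrightarrow>
      op_norm (measure_pmf.expectation (cond_pmf p (B \<inter> C)) f - measure_pmf.expectation (cond_pmf p (B - C)) f) \<le> b"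
    and "0 \<le> b"
  shows "op_norm (measure_pmf.expectation (cond_pmf p (B \<inter> C)) f - measure_pmf.expectation (cond_pmf p B) f) \<le> b"
proof (cases "set_pmf p \<inter> (B - C) = {}")
  case True
  then have "cond_pmf p (B \<inter> C) = cond_pmf p B"
    using ne by (intro cond_pmf_cong_set_pmf) auto
  then show ?thesis
    using \<open>0 \<le> b\<close> by simp
next
  case False
  obtain q where "0 \<le> q" "q \<le> 1" and split:
    "measure_pmf.expectation (cond_pmf p (B \<inter> C)) f - measure_pmf.expectation (cond_pmf p B) f
     = q *\<^sub>R (measure_pmf.expectation (cond_pmf p (B \<inter> C)) f - measure_pmf.expectation (cond_pmf p (B - C)) f)"
    using expectation_cond_pmf_split[OF fin ne False] by blast
  then show ?thesis
    using halves[OF False] by (simp add: op_norm_scaleR) (meson mult_left_le_one_le op_norm_nonneg order_trans)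
qed

lemma op_norm_cond_expectation_reveal_le:
  fixes f :: "nat set \<Rightarrow> complex^'d^'d"
  assumes f_lip: "\<forall>x y. x \<subseteq> {1..n} \<longrightarrow> y \<subseteq> {1..n} \<longrightarrow> op_norm (f x - f y) \<le> dist_alpha n \<alpha> x y"
    and X_range: "set_pmf X \<subseteq> Pow {1..n}"
    and X_hom: "\<forall>A\<in>set_pmf X. card A = k"
    and X_scp: "stoch_covering n X"
    and R: "R \<subseteq> {1..n}" "a \<in> {1..n}"
    and \<beta>: "\<forall>j\<in>{1..n} - R. \<alpha> j \<le> \<beta>" "0 \<le> \<beta>"
    and A0: "A0 \<in> set_pmf X"
  shows "op_norm (measure_pmf.expectation (cond_pmf X {A. A \<inter> insert a R = A0 \<inter> insert a R}) f
               - measure_pmf.expectation (cond_pmf X {A. A \<inter> R = A0 \<inter> R}) f) \<le> 2 * \<beta>"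
proof (cases "a \<in> R")
  case True
  then show ?thesis
    using \<beta>(2) by (simp add: insert_absorb)
next
  case False
  define B where "B = {A. A \<inter> R = A0 \<inter> R}"
  define C where "C = {A. (a \<in> A) = (a \<in> A0)}"
  have "{A. A \<inter> insert a R = A0 \<inter> R} = (if a \<in> A0 then B - C else B \<inter> C)"
    "{A. A \<inter> insert a R = insert a (A0 \<inter> R)} = (if a \<in> A0 then B \<inter> C else B - C)"
    "{A. A \<inter> insert a R = A0 \<inter> insert a R} = B \<inter> C"
    using False by (auto simp: B_def C_def)
  moreover have "set_pmf X \<inter> (B \<inter> C) \<noteq> {}"
    using A0 by (auto simp: B_def C_def)
  moreover have "finite (set_pmf X)"
    using X_range by (rule finite_subset) simp
  ultimately show ?thesis
    using op_norm_cond_expectation_insert_le[OF f_lip X_range X_hom X_scp R(1) _ _ \<beta>(1), of "A0 \<inter> R" a]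
      op_norm_cond_expectation_Int_le[of X B C f "2 * \<beta>"] \<beta>(2) R(2) False
    by (auto simp: op_norm_minus_commute B_def split: if_splits)
qed

section \<open>The martingale differences\<close>

lemma mart_diff_eq_revealed:
  assumes "set_pmf X \<subseteq> Pow {1..n}" "\<forall>A\<in>set_pmf X. card A = k"
    and "\<omega> \<in> set_pmf (joint k X)" "l \<le> 2 * k"
  shows "mart_diff f k X l \<omega> =
      measure_pmf.expectation (cond_pmf X {A. A \<inter> revealed k l (snd \<omega>) = fst \<omega> \<inter> revealed k l (snd \<omega>)}) f
    - measure_pmf.expectation (cond_pmf X {A. A \<inter> revealed k (l - 1) (snd \<omega>) = fst \<omega> \<inter> revealed k (l - 1) (snd \<omega>)}) f"
  unfolding mart_diff_def
  using cond_exp_joint_eq_revealed[OF assms(1,2), of "fst \<omega>" "snd \<omega>" l f]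
    cond_exp_joint_eq_revealed[OF assms(1,2), of "fst \<omega>" "snd \<omega>" "l - 1" f] assms(3,4)
  by simp

lemma hermitian_mart_diff:
  fixes f :: "nat set \<Rightarrow> complex^'d^'d"
  assumes f_herm: "\<forall>x. x \<subseteq> {1..n} \<longrightarrow> hermitian_mat (f x)"
    and X_range: "set_pmf X \<subseteq> Pow {1..n}" and X_hom: "\<forall>A\<in>set_pmf X. card A = k"
    and \<omega>: "\<omega> \<in> set_pmf (joint k X)" and "l \<le> 2 * k"
  shows "hermitian_mat (mart_diff f k X l \<omega>)"
proof -
  have "fst \<omega> \<in> set_pmf X"
    using \<omega> by (auto simp: joint_def)
  have "finite (set_pmf X)"
    using X_range by (rule finite_subset) simp
  have "hermitian_mat (measure_pmf.expectation (cond_pmf X {A. A \<inter> R = fst \<omega> \<inter> R}) f)" for R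
  proof (rule hermitian_mat_expectation)
    have ne: "set_pmf X \<inter> {A. A \<inter> R = fst \<omega> \<inter> R} \<noteq> {}"
      using \<open>fst \<omega> \<in> set_pmf X\<close> by blast
    then show "finite (set_pmf (cond_pmf X {A. A \<inter> R = fst \<omega> \<inter> R}))"
      using \<open>finite (set_pmf X)\<close> by simp
    show "hermitian_mat (f w)" if "w \<in> set_pmf (cond_pmf X {A. A \<inter> R = fst \<omega> \<inter> R})" for w
      using that ne f_herm X_range by auto
  qed
  then show ?thesis
    using mart_diff_eq_revealed[OF X_range X_hom \<omega> \<open>l \<le> 2 * k\<close>, of f] by (simp add: hermitian_mat_diff)
qed

lemma op_norm_mart_diff_le:
  fixes f :: "nat set \<Rightarrow> complex^'d^'d"
  assumes alpha_nonneg: "\<forall>i\<in>{1..n}. 0 \<le> \<alpha> i"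
    and alpha_noninc: "\<forall>i\<in>{1..n}. \<forall>j\<in>{1..n}. i \<le> j \<longrightarrow> \<alpha> j \<le> \<alpha> i"
    and f_lip: "\<forall>x y. x \<subseteq> {1..n} \<longrightarrow> y \<subseteq> {1..n} \<longrightarrow> op_norm (f x - f y) \<le> dist_alpha n \<alpha> x y"
    and X_range: "set_pmf X \<subseteq> Pow {1..n}"
    and X_hom: "\<forall>A\<in>set_pmf X. card A = k"
    and X_scp: "stoch_covering n X"
    and \<omega>: "\<omega> \<in> set_pmf (joint k X)" and l: "l \<in> {1..2 * k}"
  shows "op_norm (mart_diff f k X l \<omega>) \<le> 2 * \<alpha> (min l k)"
proof -
  obtain m where m: "l = Suc m" "m < 2 * k"
    using l by (cases l) auto
  have "fst \<omega> \<in> set_pmf X" and ys0: "snd \<omega> \<in> set_pmf (Ys k (fst \<omega>) k)"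
    using \<omega> by (auto simp: joint_def)
  then have A0: "fst \<omega> \<in> set_pmf X" "fst \<omega> \<subseteq> {1..n}" "card (fst \<omega>) = k"
    using X_range X_hom by auto
  then have "k \<le> n"
    using card_mono[of "{1..n}" "fst \<omega>"] by simp
  then have "min l k \<in> {1..n}"
    using l by auto
  define R where "R = revealed k m (snd \<omega>)"
  have R: "R \<subseteq> {1..n}"
    unfolding R_def using A0(2,3) ys0 by (rule revealed_subset)
  have far: "\<forall>j\<in>{1..n} - R. \<alpha> j \<le> \<alpha> (min l k)"
    using alpha_noninc \<open>min l k \<in> {1..n}\<close> min_Suc_le_if_not_revealed[of _ k m "snd \<omega>"]
    by (auto simp: R_def m(1))
  have "0 \<le> \<alpha> (min l k)"
    using alpha_nonneg \<open>min l k \<in> {1..n}\<close> by blast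
  have diff: "mart_diff f k X l \<omega> =
      measure_pmf.expectation (cond_pmf X {A. A \<inter> revealed k l (snd \<omega>) = fst \<omega> \<inter> revealed k l (snd \<omega>)}) f
    - measure_pmf.expectation (cond_pmf X {A. A \<inter> R = fst \<omega> \<inter> R}) f"
    using mart_diff_eq_revealed[OF X_range X_hom \<omega>, of l f] l m(1) by (simp add: R_def)
  from revealed_Suc_cases[OF A0(2,3) ys0 m(2)] show ?thesis
  proof
    assume "revealed k (Suc m) (snd \<omega>) = revealed k m (snd \<omega>)"
    then show ?thesis
      using diff m(1) \<open>0 \<le> \<alpha> (min l k)\<close> by (simp add: R_def)
  next
    assume "\<exists>a\<in>{1..n}. revealed k (Suc m) (snd \<omega>) = insert a (revealed k m (snd \<omega>))"
    then obtain a where "a \<in> {1..n}" "revealed k l (snd \<omega>) = insert a R"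
      using m(1) by (auto simp: R_def)
    then show ?thesis
      using diff op_norm_cond_expectation_reveal_le[OF f_lip X_range X_hom X_scp R \<open>a \<in> {1..n}\<close> far
          \<open>0 \<le> \<alpha> (min l k)\<close> A0(1)]
      by simp
  qed
qed

lemma mart_diff_square_le:
  fixes f :: "nat set \<Rightarrow> complex^'d^'d"
  assumes alpha_nonneg: "\<forall>i\<in>{1..n}. 0 \<le> \<alpha> i"
    and alpha_noninc: "\<forall>i\<in>{1..n}. \<forall>j\<in>{1..n}. i \<le> j \<longrightarrow> \<alpha> j \<le> \<alpha> i"
    and f_herm: "\<forall>x. x \<subseteq> {1..n} \<longrightarrow> hermitian_mat (f x)"
    and f_lip: "\<forall>x y. x \<subseteq> {1..n} \<longrightarrow> y \<subseteq> {1..n} \<longrightarrow> op_norm (f x - f y) \<le> dist_alpha n \<alpha> x y"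
    and X_range: "set_pmf X \<subseteq> Pow {1..n}"
    and X_hom: "\<forall>A\<in>set_pmf X. card A = k"
    and X_scp: "stoch_covering n X"
    and \<omega>: "\<omega> \<in> set_pmf (joint k X)" and l: "l \<in> {1..2 * k}"
  shows "psd_le (mart_diff f k X l \<omega> ** mart_diff f k X l \<omega>) ((4 * (\<alpha> (min l k))\<^sup>2) *\<^sub>R mat 1)"
  using psd_le_square_if_op_norm_le[OF hermitian_mart_diff[OF f_herm X_range X_hom \<omega>]
      op_norm_mart_diff_le[OF alpha_nonneg alpha_noninc f_lip X_range X_hom X_scp \<omega> l]] l
  by (simp add: power_mult_distrib)

theorem lemma5p2:
  fixes n k :: nat and \<alpha> :: "nat \<Rightarrow> real"
    and f :: "nat set \<Rightarrow> complex^'d^'d" and X :: "nat set pmf"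
  assumes alpha_nonneg: "\<forall>i\<in>{1..n}. 0 \<le> \<alpha> i"
    and alpha_noninc: "\<forall>i\<in>{1..n}. \<forall>j\<in>{1..n}. i \<le> j \<longrightarrow> \<alpha> j \<le> \<alpha> i"
    and f_herm: "\<forall>x. x \<subseteq> {1..n} \<longrightarrow> hermitian_mat (f x)"
    and f_lip: "\<forall>x y. x \<subseteq> {1..n} \<longrightarrow> y \<subseteq> {1..n} \<longrightarrow> op_norm (f x - f y) \<le> dist_alpha n \<alpha> x y"
    and X_range: "set_pmf X \<subseteq> Pow {1..n}"
    and X_hom: "\<forall>A\<in>set_pmf X. card A = k"
    and X_scp: "stoch_covering n X"
  shows "\<forall>\<omega>\<in>set_pmf (joint k X).
           (\<forall>l\<in>{1..k}. psd_le (mart_diff f k X l \<omega> ** mart_diff f k X l \<omega>)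
                                 ((4 * (\<alpha> l)\<^sup>2) *\<^sub>R mat 1))
         \<and> (\<forall>l\<in>{k+1..2*k}. psd_le (mart_diff f k X l \<omega> ** mart_diff f k X l \<omega>)
                                 ((4 * (\<alpha> k)\<^sup>2) *\<^sub>R mat 1))"
proof (intro ballI conjI)
  fix \<omega> l
  assume "\<omega> \<in> set_pmf (joint k X)" "l \<in> {1..k}"
  then show "psd_le (mart_diff f k X l \<omega> ** mart_diff f k X l \<omega>) ((4 * (\<alpha> l)\<^sup>2) *\<^sub>R mat 1)"
    using mart_diff_square_le[OF assms, of \<omega> l] by simp
next
  fix \<omega> l
  assume "\<omega> \<in> set_pmf (joint k X)" "l \<in> {k+1..2*k}"
  then show "psd_le (mart_diff f k X l \<omega> ** mart_diff f k X l \<omega>) ((4 * (\<alpha> k)\<^sup>2) *\<^sub>R mat 1)"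
    using mart_diff_square_le[OF assms, of \<omega> l] by simp
qed

end
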